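(* Let $a,b,c>0$, $\Delta t>0$, $\alpha\ge\frac12$, $\mathbf{A}=\begin{pmatrix}-ac & bc\\ a&-b\end{pmatrix}$, and let $\mathbf{y}^*>\mathbf{0}$ be an arbitrary steady state of $\mathbf{y}'=\mathbf{A}\mathbf{y}$ (i.e. $\mathbf{y}^*\in\ker(\mathbf{A})\cap\mathbb{R}^2_{>0}$). Let $\pi_1,\pi_2,r,q\in\mathcal{C}^2(\mathbb{R}^2_{>0},\mathbb{R}_{>0})$, $\boldsymbol{\pi}=(\pi_1,\pi_2)^{\mathsf T}$, $\boldsymbol{\sigma}\in\mathcal{C}^2(\mathbb{R}^2_{>0}\times\mathbb{R}^2_{>0},\mathbb{R}^2_{>0})$, and suppose that $\boldsymbol{\sigma}(\mathbf{v},\mathbf{v})=\boldsymbol{\pi}(\mathbf{v})=\mathbf{v}$ for all $\mathbf{v}\in\ker(\mathbf{A})\cap\mathcal{D}$, where $\mathcal{D}$ is a sufficiently small neighborhood of $\mathbf{y}^*$. Then the gBBKS2($\alpha$) scheme (defined in the context) has the same stability function as the underlying Runge--Kutta method, i.e. $R(z)=1+z+\frac{z^2}{2}$, and the following holds. a) If $|R(-(ac+b)\Delta t)|<1$, then $\mathbf{y}^*$ is a stable fixed point of the gBBKS2($\alpha$) scheme and there exists a $\delta>0$ such that $(1,c)\mathbf{y}^0=(1,c)\mathbf{y}^*$ and $\|\mathbf{y}^0-\mathbf{y}^*\|<\delta$ imply $\mathbf{y}^n\to\mathbf{y}^*$ as $n\to\infty$. b) If $|R(-(ac+b)\Delta t)|>1$,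 then $\mathbf{y}^*$ is an unstable fixed point of the gBBKS2($\alpha$) scheme.
   Context: The second order gBBKS scheme gBBKS2($\alpha$) applied to $\mathbf{y}'=\mathbf{A}\mathbf{y}$ is implicitly given, for $\mathbf{y}^n\in\mathbb{R}^2_{>0}$ and $i=1,2$, by $$y_i^{(2)}=y_i^n+\alpha\Delta t(\mathbf{A}\mathbf{y}^n)_i\Bigl(\prod_{j\in J^n}\frac{y_j^{(2)}}{\pi_j(\mathbf{y}^n)}\Bigr)^{q(\mathbf{y}^n)},$$ $$y_i^{n+1}=y_i^n+\Delta t\Bigl(\bigl(1-\tfrac1{2\alpha}\bigr)(\mathbf{A}\mathbf{y}^n)_i+\tfrac1{2\alpha}(\mathbf{A}\mathbf{y}^{(2)})_i\Bigr)\Bigl(\prod_{m\in M^n}\frac{y_m^{n+1}}{\sigma_m(\mathbf{y}^n,\mathbf{y}^{(2)})}\Bigr)^{r(\mathbf{y}^n)},$$ where $$J^n=\{j\in\{1,2\}\mid(\mathbf{A}\mathbf{y}^n)_j<0\},\qquad M^n=\Bigl\{m\in\{1,2\}\;\Big|\;\bigl(1-\tfrac1{2\alpha}\bigr)(\mathbf{A}\mathbf{y}^n)_m+\tfrac1{2\alpha}(\mathbf{A}\mathbf{y}^{(2)})_m<0\Bigr\},$$ and empty products equal $1$. It is known that for each $\mathbf{y}^n\in\mathbb{R}^2_{>0}$ these equations have unique solutions $\mathbf{y}^{(2)},\mathbf{y}^{n+1}\in\mathbb{R}^2_{>0}$; the resulting map is $\mathbf{g}\colon\mathbb{R}^2_{>0}\to\mathbb{R}^2_{>0}$,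 $\mathbf{y}^{n+1}=\mathbf{g}(\mathbf{y}^n)$. The eigenvalues of $\mathbf{A}$ are $0$ and $\lambda=-(ac+b)$. That $R$ is the stability function means that the eigenvalues of the Jacobian $\mathbf{D}\mathbf{g}(\mathbf{y}^* )$ are $1$ and $R(\Delta t\lambda)$. A fixed point $\mathbf{y}^*$ of $\mathbf{y}^{n+1}=\mathbf{g}(\mathbf{y}^n)$ is stable if for any $\epsilon>0$ there is $\delta>0$ such that $\|\mathbf{y}^0-\mathbf{y}^*\|<\delta$ implies $\|\mathbf{y}^n-\mathbf{y}^*\|<\epsilon$ for all $n\ge0$; it is unstable if it is not stable. *)

theory Defs
  imports "HOL-Analysis.Analysis"
begin

definition C2_on :: "'a::real_normed_vector set \<Rightarrow> ('a \<Rightarrow> 'b::real_normed_vector) \<Rightarrow> bool" where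
  "C2_on S f \<longleftrightarrow>
     (\<exists>(f' :: 'a \<Rightarrow> 'a \<Rightarrow>\<^sub>L 'b) (f'' :: 'a \<Rightarrow> 'a \<Rightarrow>\<^sub>L ('a \<Rightarrow>\<^sub>L 'b)).
        (\<forall>x\<in>S. (f has_derivative blinfun_apply (f' x)) (at x)) \<and>
        (\<forall>x\<in>S. (f' has_derivative blinfun_apply (f'' x)) (at x)) \<and>
        continuous_on S f'')"

(* Geometric spectrum over the complex numbers. For a real 2x2 matrix with a real eigenvalue,
   it also determines the algebraic multiplicities. *)
definition eigenvalues :: "real^'n^'n \<Rightarrow> complex set" where
  "eigenvalues M = {\<mu>. \<exists>v. v \<noteq> 0 \<and> map_matrix complex_of_real M *v v = \<mu> *s v}"

definition stable_fixed_point :: "'a::real_normed_vector set \<Rightarrow> ('a \<Rightarrow> 'a) \<Rightarrow> 'a \<Rightarrow> bool" where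
  "stable_fixed_point X g ystar \<longleftrightarrow> ystar \<in> X \<and> g ystar = ystar \<and>
     (\<forall>\<epsilon>>0. \<exists>\<delta>>0. \<forall>y0\<in>X. norm (y0 - ystar) < \<delta> \<longrightarrow> (\<forall>n. norm ((g ^^ n) y0 - ystar) < \<epsilon>))"

definition unstable_fixed_point :: "'a::real_normed_vector set \<Rightarrow> ('a \<Rightarrow> 'a) \<Rightarrow> 'a \<Rightarrow> bool" where
  "unstable_fixed_point X g ystar \<longleftrightarrow> ystar \<in> X \<and> g ystar = ystar \<and> \<not> stable_fixed_point X g ystar"

definition pos_quadrant :: "(real^2) set" where
  "pos_quadrant = {y. \<forall>i. 0 < y $ i}"

text \<open>Explicit two-stage second order Runge--Kutta method with
  nodes \<open>0, \<alpha>\<close> and weights \<open>1 - 1/(2\<alpha>), 1/(2\<alpha>)\<close>.\<close>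

definition rk2_step :: "real \<Rightarrow> real \<Rightarrow> ('a::real_vector \<Rightarrow> 'a) \<Rightarrow> 'a \<Rightarrow> 'a" where
  "rk2_step \<alpha> h f y =
     (let y2 = y + (\<alpha> * h) *\<^sub>R f y
      in y + h *\<^sub>R ((1 - 1 / (2 * \<alpha>)) *\<^sub>R f y + (1 / (2 * \<alpha>)) *\<^sub>R f y2))"

(* One step of size 1 for the Dahlquist equation u' = z * u, started at u = 1. *)
definition rk2_stability_function :: "real \<Rightarrow> complex \<Rightarrow> complex" where
  "rk2_stability_function \<alpha> z = rk2_step \<alpha> 1 (\<lambda>u. z * u) 1"

definition gbbks2_stage_eq ::
  "real \<Rightarrow> real \<Rightarrow> real^2^2 \<Rightarrow> (real^2 \<Rightarrow> real^2) \<Rightarrow> (real^2 \<Rightarrow> real) \<Rightarrow>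
   real^2 \<Rightarrow> real^2 \<Rightarrow> bool" where
  "gbbks2_stage_eq \<alpha> h A p q y y2 \<longleftrightarrow>
     (\<forall>i. y2 $ i = y $ i + \<alpha> * h * (A *v y) $ i *
        (\<Prod>j\<in>{j. (A *v y) $ j < 0}. y2 $ j / p y $ j) powr q y)"

definition gbbks2_update_eq ::
  "real \<Rightarrow> real \<Rightarrow> real^2^2 \<Rightarrow> ((real^2) \<times> (real^2) \<Rightarrow> real^2) \<Rightarrow> (real^2 \<Rightarrow> real) \<Rightarrow>
   real^2 \<Rightarrow> real^2 \<Rightarrow> real^2 \<Rightarrow> bool" where
  "gbbks2_update_eq \<alpha> h A s r y y2 y' \<longleftrightarrow>
     (let w = (\<lambda>i. (1 - 1 / (2 * \<alpha>)) * (A *v y) $ i + 1 / (2 * \<alpha>) * (A *v y2) $ i)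
      in \<forall>i. y' $ i = y $ i + h * w i * (\<Prod>m\<in>{m. w m < 0}. y' $ m / s (y, y2) $ m) powr r y)"

(* Each description is unique on the positive quadrant when p, q, s, r are positive there, h and
   \<alpha> are positive and A has a left null vector (1, c) with c > 0: then at most one component of
   A *v y (and of the weighted sum) is negative. Outside the quadrant the value is arbitrary. *)
definition gbbks2 ::
  "real \<Rightarrow> real \<Rightarrow> real^2^2 \<Rightarrow> (real^2 \<Rightarrow> real^2) \<Rightarrow> (real^2 \<Rightarrow> real) \<Rightarrow>
   ((real^2) \<times> (real^2) \<Rightarrow> real^2) \<Rightarrow> (real^2 \<Rightarrow> real) \<Rightarrow> real^2 \<Rightarrow> real^2" where
  "gbbks2 \<alpha> h A p q s r y =
     (let y2 = (THE y2. y2 \<in> pos_quadrant \<and> gbbks2_stage_eq \<alpha> h A p q y y2)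
      in THE y'. y' \<in> pos_quadrant \<and> gbbks2_update_eq \<alpha> h A s r y y2 y')"

(* R is the stability function of the one-step map g at ystar, for step size h and a linear
   2x2 system with eigenvalues 0 and l. *)
definition has_stability_function ::
  "(real^2 \<Rightarrow> real^2) \<Rightarrow> real^2 \<Rightarrow> real \<Rightarrow> real \<Rightarrow> (complex \<Rightarrow> complex) \<Rightarrow> bool" where
  "has_stability_function g ystar h l R \<longleftrightarrow>
     g differentiable (at ystar) \<and>
     eigenvalues (jacobian g (at ystar)) = {1, R (complex_of_real (h * l))}"

end

(* Every step moves along the range of A: g y = y + G y *R A y with a scalar G that tends to
   dt * (1 + dt * l / 2) at ystar, l = -(a * c + b), because both Patankar weights tend to 1 there.
   Since A (A v) = l *R A v, the vector l *R y - A y is conserved exactly, while A y is multiplied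
   by 1 + l * G y, which tends to R (dt * l). So the dynamics near ystar is governed by a scalar
   factor, and no centre manifold argument is needed. *)

theory Submission
  imports Defs
begin

section \<open>Iterations along the range of a linear map with a single nonzero eigenvalue\<close>

text \<open>Keeps only what the dynamics depend on: a scalar factor \<open>G\<close> with a limit,
  not the implicit equations behind it. The limit over \<open>nhds ystar\<close> forces
  \<open>G ystar = k\<close>, so bounds on the factor hold on a full ball around
  \<open>ystar\<close>.\<close>

locale range_iteration =
  fixes A g :: "'a::real_normed_vector \<Rightarrow> 'a" and G :: "'a \<Rightarrow> real" and X :: "'a set"
    and ystar :: 'a and l k :: real
  assumes A_bl: "bounded_linear A"
    and A_A: "A (A v) = l *\<^sub>R A v"
    and l_nz: "l \<noteq> 0"
    and X: "open X" "ystar \<in> X"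
    and A_ystar: "A ystar = 0"
    and g_eq: "y \<in> X \<Longrightarrow> g y = y + G y *\<^sub>R A y"
    and G_lim: "(G \<longlongrightarrow> k) (nhds ystar)"
begin

lemma g_ystar: "g ystar = ystar"
  using g_eq[OF X(2)] A_ystar by simp

lemma A_g: "y \<in> X \<Longrightarrow> A (g y) = (1 + l * G y) *\<^sub>R A y"
  by (simp add: g_eq linear_simps[OF A_bl] A_A scaleR_left_distrib mult.commute)

lemma factor_lim: "((\<lambda>y. \<bar>1 + l * G y\<bar>) \<longlongrightarrow> \<bar>1 + l * k\<bar>) (nhds ystar)"
  by (intro tendsto_intros G_lim)

text \<open>Continuity of \<open>G\<close> at \<open>ystar\<close> suffices: since
  \<open>A y = A (y - ystar)\<close>, the remainder is exactly
  \<open>(G y - k) *\<^sub>R A (y - ystar)\<close>, a vanishing factor times a linear term.\<close>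

lemma has_derivative_g: "(g has_derivative (\<lambda>v. v + k *\<^sub>R A v)) (at ystar)"
proof -
  have bl: "bounded_linear (\<lambda>v. v + k *\<^sub>R A v)"
    by (intro bounded_linear_add bounded_linear_ident bounded_linear_const_scaleR A_bl)
  obtain K where K: "\<And>v. norm (A v) \<le> norm v * K" "K > 0"
    using bounded_linear.pos_bounded[OF A_bl] by blast
  have ev: "\<forall>\<^sub>F y in at ystar. y \<in> X"
    using X by (rule eventually_at_in_open')
  have "(G \<longlongrightarrow> k) (at ystar)"
    using G_lim tendsto_mono[OF at_within_le_nhds] by blast
  then have lim: "((\<lambda>y. \<bar>G y - k\<bar> * K) \<longlongrightarrow> 0) (at ystar)"
    by (auto intro!: tendsto_eq_intros)
  have "((\<lambda>y. norm (g y - g ystar - ((y - ystar) + k *\<^sub>R A (y - ystar))) / norm (y - ystar))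
      \<longlongrightarrow> 0) (at ystar)"
  proof (rule tendsto_sandwich[OF _ _ tendsto_const lim])
    show "\<forall>\<^sub>F y in at ystar. norm (g y - g ystar - ((y - ystar) + k *\<^sub>R A (y - ystar)))
        / norm (y - ystar) \<le> \<bar>G y - k\<bar> * K"
      using ev
    proof (rule eventually_mono)
      fix y assume y: "y \<in> X"
      have Ay: "A (y - ystar) = A y"
        by (simp add: linear_simps[OF A_bl] A_ystar)
      have "g y - g ystar - ((y - ystar) + k *\<^sub>R A (y - ystar)) = (G y - k) *\<^sub>R A (y - ystar)"
        unfolding g_ystar Ay g_eq[OF y] by (simp add: algebra_simps)
      then have "norm (g y - g ystar - ((y - ystar) + k *\<^sub>R A (y - ystar)))
          \<le> \<bar>G y - k\<bar> * (norm (y - ystar) * K)"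
        using K(1) by (simp add: mult_left_mono)
      then show "norm (g y - g ystar - ((y - ystar) + k *\<^sub>R A (y - ystar)))
          / norm (y - ystar) \<le> \<bar>G y - k\<bar> * K"
        using K(2) by (cases "y = ystar") (auto simp: divide_simps mult_ac)
    qed
  qed auto
  then show ?thesis
    using bl by (simp add: has_derivative_iff_norm)
qed

text \<open>A point \<open>z\<close> is recovered from \<open>l *\<^sub>R z - A z\<close> and
  \<open>A z\<close>. The first is conserved, and the second shrinks by \<kappa> as long as the
  factor stays below \<kappa>, so an orbit that starts close enough never leaves the ball where this
  bound holds.\<close>

lemma contraction_orbit:
  assumes "\<bar>1 + l * k\<bar> < \<kappa>" "\<kappa> < 1" "\<epsilon> > 0"
  shows "\<exists>\<delta>>0. \<forall>y. norm (y - ystar) < \<delta> \<longrightarrow> (\<forall>n. norm ((g ^^ n) y - ystar) < \<epsilon> \<and>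
    l *\<^sub>R (g ^^ n) y - A ((g ^^ n) y) = l *\<^sub>R y - A y \<and>
    norm (A ((g ^^ n) y)) \<le> \<kappa> ^ n * norm (A y))"
proof -
  have \<kappa>0: "0 \<le> \<kappa>"
    using assms(1) by linarith
  have "\<forall>\<^sub>F y in nhds ystar. y \<in> X \<and> \<bar>1 + l * G y\<bar> < \<kappa>"
    using X assms(1) factor_lim
    by (intro eventually_conj eventually_nhds_in_open order_tendstoD(2)[where a = \<kappa>]) auto
  then obtain d where d: "d > 0" "\<And>y. dist y ystar < d \<Longrightarrow> y \<in> X \<and> \<bar>1 + l * G y\<bar> < \<kappa>"
    unfolding eventually_nhds_metric by blast
  obtain K where K: "\<And>v. norm (A v) \<le> norm v * K" "K > 0"
    using bounded_linear.pos_bounded[OF A_bl] by blast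
  \<comment> \<open>The minimum keeps the orbit where the factor bound is valid; \<delta> is then
    the radius for which the estimate in \<open>small\<close> yields
    \<open>\<bar>l\<bar> * e\<close>.\<close>
  define e where "e = min \<epsilon> d"
  define \<delta> where "\<delta> = \<bar>l\<bar> * e / (\<bar>l\<bar> + 2 * K)"
  have e: "e > 0" "e \<le> \<epsilon>" "e \<le> d"
    using d(1) assms(3) by (auto simp: e_def)
  have den: "\<bar>l\<bar> + 2 * K > 0"
    using K(2) by linarith
  have \<delta>: "\<delta> > 0" "(\<bar>l\<bar> + 2 * K) * \<delta> = \<bar>l\<bar> * e"
    using den e(1) l_nz by (auto simp: \<delta>_def)
  have "norm ((g ^^ n) y - ystar) < e \<and>
      l *\<^sub>R (g ^^ n) y - A ((g ^^ n) y) = l *\<^sub>R y - A y \<and>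
      norm (A ((g ^^ n) y)) \<le> \<kappa> ^ n * norm (A y)"
    if y: "norm (y - ystar) < \<delta>" for y n
  proof -
    \<comment> \<open>The invariant and the size of \<open>A z\<close> alone control the distance to
      \<open>ystar\<close>. The term \<open>2 * K\<close> accounts for \<open>A y\<close> and
      \<open>A z\<close>, both at most \<open>norm (A y)\<close>.\<close>
    have small: "norm (z - ystar) < e"
      if z: "l *\<^sub>R z - A z = l *\<^sub>R y - A y" "norm (A z) \<le> norm (A y)" for z
    proof -
      have "l *\<^sub>R (z - ystar) = (l *\<^sub>R z - A z) + A z - l *\<^sub>R ystar"
        by (simp add: algebra_simps)
      also have "\<dots> = l *\<^sub>R (y - ystar) - A y + A z"
        unfolding z(1) by (simp add: algebra_simps)
      finally have "norm (l *\<^sub>R (z - ystar)) \<le> norm (l *\<^sub>R (y - ystar)) + norm (A y) + norm (A z)"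
        using norm_triangle_ineq[of "l *\<^sub>R (y - ystar) - A y" "A z"]
          norm_triangle_ineq4[of "l *\<^sub>R (y - ystar)" "A y"] by simp
      also have "\<dots> \<le> \<bar>l\<bar> * norm (y - ystar) + 2 * norm (A y)"
        using z(2) by simp
      also have "A y = A (y - ystar)"
        by (simp add: linear_simps[OF A_bl] A_ystar)
      also have "\<bar>l\<bar> * norm (y - ystar) + 2 * norm (A (y - ystar))
          \<le> (\<bar>l\<bar> + 2 * K) * norm (y - ystar)"
        using K(1)[of "y - ystar"] by (simp add: algebra_simps)
      also have "\<dots> < \<bar>l\<bar> * e"
        using y den \<delta>(2) by (metis mult_strict_left_mono)
      finally show ?thesis
        using l_nz by simp
    qed
    show ?thesis
    \<comment> \<open>The three claims depend on each other: closeness gives the factor bound for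
      the next step, while conservation and the bound on \<open>A\<close> give closeness
      back.\<close>
    proof (induction n)
      case 0
      show ?case using small[of y] by simp
    next
      case (Suc n)
      define z where "z = (g ^^ n) y"
      have z: "norm (z - ystar) < e" "l *\<^sub>R z - A z = l *\<^sub>R y - A y"
          "norm (A z) \<le> \<kappa> ^ n * norm (A y)"
        using Suc by (auto simp: z_def)
      have zX: "z \<in> X" "\<bar>1 + l * G z\<bar> < \<kappa>"
        using d(2)[of z] z(1) e(3) by (auto simp: dist_norm)
      have 1: "l *\<^sub>R g z - A (g z) = l *\<^sub>R y - A y"
        unfolding z(2)[symmetric] A_g[OF zX(1)] using g_eq[OF zX(1)] by (simp add: algebra_simps)
      have "norm (A (g z)) = \<bar>1 + l * G z\<bar> * norm (A z)"
        by (simp add: A_g[OF zX(1)])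
      also have "\<dots> \<le> \<kappa> * (\<kappa> ^ n * norm (A y))"
        using zX(2) z(3) \<kappa>0 by (intro mult_mono) auto
      finally have 2: "norm (A (g z)) \<le> \<kappa> ^ Suc n * norm (A y)"
        by simp
      have "\<kappa> ^ Suc n \<le> 1"
        using \<kappa>0 assms(2) by (intro power_le_one) auto
      then have "norm (A (g z)) \<le> norm (A y)"
        using 2 by (meson mult_left_le_one_le norm_ge_zero order_trans \<kappa>0 zero_le_power)
      then show ?case
        using 1 2 small[of "g z"] by (simp add: z_def)
    qed
  qed
  then show ?thesis
    using \<delta>(1) e(2) by (meson less_le_trans)
qed

lemma stable:
  assumes "\<bar>1 + l * k\<bar> < 1"
  shows "stable_fixed_point X g ystar"
proof -
  obtain \<kappa> where "\<bar>1 + l * k\<bar> < \<kappa>" "\<kappa> < 1"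
    using dense[OF assms] by blast
  from contraction_orbit[OF this] show ?thesis
    unfolding stable_fixed_point_def using X g_ystar by meson
qed

text \<open>The first condition puts \<open>y\<close> in the level set of
  \<open>l *\<^sub>R z - A z\<close> through \<open>ystar\<close>. On it
  \<open>z = ystar + (1 / l) *\<^sub>R A z\<close>, so the geometric decay of \<open>A z\<close> is
  convergence to \<open>ystar\<close>.\<close>

lemma convergent_in_fibre:
  assumes "\<bar>1 + l * k\<bar> < 1"
  shows "\<exists>\<delta>>0. \<forall>y. l *\<^sub>R (y - ystar) = A (y - ystar) \<and> norm (y - ystar) < \<delta> \<longrightarrow>
    (\<lambda>n. (g ^^ n) y) \<longlonglongrightarrow> ystar"
proof -
  obtain \<kappa> where \<kappa>: "\<bar>1 + l * k\<bar> < \<kappa>" "\<kappa> < 1"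
    using dense[OF assms] by blast
  \<comment> \<open>The choice \<epsilon> = 1 is arbitrary: only conservation and geometric decay
    are extracted.\<close>
  from contraction_orbit[OF this, of 1] obtain \<delta> where \<delta>: "\<delta> > 0"
    and orbit: "\<And>y n. norm (y - ystar) < \<delta> \<Longrightarrow>
      l *\<^sub>R (g ^^ n) y - A ((g ^^ n) y) = l *\<^sub>R y - A y \<and>
      norm (A ((g ^^ n) y)) \<le> \<kappa> ^ n * norm (A y)"
    by auto
  have "(\<lambda>n. (g ^^ n) y) \<longlonglongrightarrow> ystar"
    if y: "l *\<^sub>R (y - ystar) = A (y - ystar)" "norm (y - ystar) < \<delta>" for y
  proof -
    have "(\<lambda>n. \<kappa> ^ n * norm (A y)) \<longlonglongrightarrow> 0"
      using \<kappa> by (intro tendsto_mult_left_zero LIMSEQ_power_zero) auto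
    then have "(\<lambda>n. A ((g ^^ n) y)) \<longlonglongrightarrow> 0"
      by (rule Lim_null_comparison[OF always_eventually, rotated]) (use orbit[OF y(2)] in blast)
    then have "(\<lambda>n. ystar + (1 / l) *\<^sub>R A ((g ^^ n) y)) \<longlonglongrightarrow> ystar + (1 / l) *\<^sub>R 0"
      by (intro tendsto_intros)
    moreover have "ystar + (1 / l) *\<^sub>R A ((g ^^ n) y) = (g ^^ n) y" for n
    proof -
      have "l *\<^sub>R y - A y = l *\<^sub>R ystar"
        using y(1) by (simp add: linear_simps[OF A_bl] A_ystar algebra_simps)
      then have "A ((g ^^ n) y) = l *\<^sub>R ((g ^^ n) y - ystar)"
        using orbit[OF y(2), of n] by (simp add: algebra_simps)
      then show ?thesis
        using l_nz by simp
    qed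
    ultimately show ?thesis by simp
  qed
  then show ?thesis
    using \<delta> by blast
qed

text \<open>If the fixed point were stable, an orbit started at \<open>ystar\<close> plus a small
  multiple of \<open>v\<close> would stay in a ball where each step multiplies
  \<open>norm (A z)\<close> by more than \<kappa> > 1, although \<open>A\<close> is bounded on that
  ball.\<close>

lemma unstable:
  assumes gt: "\<bar>1 + l * k\<bar> > 1" and v: "A v \<noteq> 0"
  shows "unstable_fixed_point X g ystar"
proof -
  have "\<not> stable_fixed_point X g ystar"
  proof
    assume st: "stable_fixed_point X g ystar"
    obtain \<kappa> where \<kappa>: "1 < \<kappa>" "\<kappa> < \<bar>1 + l * k\<bar>"
      using dense[OF gt] by blast
    have "\<forall>\<^sub>F y in nhds ystar. y \<in> X \<and> \<kappa> < \<bar>1 + l * G y\<bar>"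
      using X \<kappa>(2) factor_lim
      by (intro eventually_conj eventually_nhds_in_open order_tendstoD(1)[where a = \<kappa>]) auto
    then obtain d where d: "d > 0" "\<And>y. dist y ystar < d \<Longrightarrow> y \<in> X \<and> \<kappa> < \<bar>1 + l * G y\<bar>"
      unfolding eventually_nhds_metric by blast
    obtain K where K: "\<And>v. norm (A v) \<le> norm v * K" "K > 0"
      using bounded_linear.pos_bounded[OF A_bl] by blast
    from st d(1) obtain \<delta> where \<delta>: "\<delta> > 0"
      and stay: "\<And>y n. y \<in> X \<Longrightarrow> norm (y - ystar) < \<delta> \<Longrightarrow> norm ((g ^^ n) y - ystar) < d"
      unfolding stable_fixed_point_def by blast
    have v0: "v \<noteq> 0"
      using v linear_simps(3)[OF A_bl] by auto
    \<comment> \<open>The 2 makes the displacement strictly shorter than both radii, so that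
      \<open>y\<close> lies in \<open>X\<close> and within \<delta> of \<open>ystar\<close>.\<close>
    define s where "s = min \<delta> d / (2 * norm v)"
    define y where "y = ystar + s *\<^sub>R v"
    have s: "s > 0" "norm (s *\<^sub>R v) < min \<delta> d"
      using \<delta> d(1) v0 by (auto simp: s_def)
    have yX: "y \<in> X" "norm (y - ystar) < \<delta>"
      using s d(2)[of y] by (auto simp: y_def dist_norm)
    have Ay: "A y \<noteq> 0"
      using s(1) v by (simp add: y_def linear_simps[OF A_bl] A_ystar)
    have grow: "\<kappa> ^ n * norm (A y) \<le> norm (A ((g ^^ n) y))" for n
    proof (induction n)
      case (Suc n)
      define z where "z = (g ^^ n) y"
      have z: "z \<in> X" "\<kappa> < \<bar>1 + l * G z\<bar>"
        using d(2)[of z] stay[OF yX] by (auto simp: z_def dist_norm)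
      have "\<kappa> * (\<kappa> ^ n * norm (A y)) \<le> \<bar>1 + l * G z\<bar> * norm (A z)"
        using z(2) \<kappa>(1) Suc by (intro mult_mono) (auto simp: z_def)
      then show ?case
        by (simp add: A_g[OF z(1)] z_def[symmetric])
    qed simp
    have bound: "\<kappa> ^ n * norm (A y) \<le> d * K" for n
    proof -
      have "norm (A ((g ^^ n) y)) = norm (A ((g ^^ n) y - ystar))"
        by (simp add: linear_simps[OF A_bl] A_ystar)
      also have "\<dots> \<le> d * K"
        using K stay[OF yX, of n] by (meson less_imp_le mult_right_mono order_trans)
      finally show ?thesis using grow[of n] by linarith
    qed
    obtain n where "d * K / norm (A y) < \<kappa> ^ n"
      using real_arch_pow[OF \<kappa>(1)] by blast
    then show False
      using bound[of n] Ay by (simp add: field_simps)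
  qed
  then show ?thesis
    using X g_ystar by (simp add: unstable_fixed_point_def)
qed

end

section \<open>One implicit geometric Patankar step\<close>

text \<open>The left side is continuous and strictly increasing in \<open>s\<close>, vanishes at 0
  and is at least \<open>x\<close> at \<open>s = x\<close>.\<close>

lemma powr_equation_unique_solution:
  fixes x K p q :: real
  assumes "x > 0" "K \<ge> 0" "p > 0" "q > 0"
  shows "\<exists>!s. s > 0 \<and> s + K * (s / p) powr q = x"
proof -
  \<comment> \<open>Since \<open>0 powr q = 0\<close> for \<open>q > 0\<close>, the endpoint 0 can
    be included; \<open>x > 0\<close> later excludes the root \<open>s = 0\<close>.\<close>
  have "\<exists>s\<ge>0. s \<le> x \<and> s + K * (s / p) powr q = x"
  proof (rule IVT')
    show "0 + K * (0 / p) powr q \<le> x" "x \<le> x + K * (x / p) powr q" "0 \<le> x"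
      using assms by auto
    show "continuous_on {0..x} (\<lambda>s. s + K * (s / p) powr q)"
      using assms by (intro continuous_intros continuous_on_powr') auto
  qed
  then obtain s where s: "s \<ge> 0" "s + K * (s / p) powr q = x"
    by blast
  have less: "t + K * (t / p) powr q < t' + K * (t' / p) powr q" if "0 < t" "t < t'" for t t'
    using that assms
    by (intro add_less_le_mono mult_left_mono powr_mono2 divide_right_mono) auto
  show ?thesis
  proof (rule ex1I[of _ s])
    show "s > 0 \<and> s + K * (s / p) powr q = x"
      using s assms by (cases "s = 0") auto
    then show "t = s" if "t > 0 \<and> t + K * (t / p) powr q = x" for t
      using that less[of s t] less[of t s] by (metis less_irrefl linorder_neqE)
  qed
qed

text \<open>Common shape of the stage and the update equation, with step size and weights absorbed
  into the direction \<open>d\<close>.\<close>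

definition patankar_eq :: "real^2 \<Rightarrow> real^2 \<Rightarrow> real \<Rightarrow> real^2 \<Rightarrow> real^2 \<Rightarrow> bool" where
  "patankar_eq d p q y z \<longleftrightarrow>
     (\<forall>i. z $ i = y $ i + d $ i * (\<Prod>j\<in>{j. d $ j < 0}. z $ j / p $ j) powr q)"

definition patankar :: "real^2 \<Rightarrow> real^2 \<Rightarrow> real \<Rightarrow> real^2 \<Rightarrow> real^2" where
  "patankar d p q y = (THE z. z \<in> pos_quadrant \<and> patankar_eq d p q y z)"

definition patankar_weight :: "real^2 \<Rightarrow> real^2 \<Rightarrow> real \<Rightarrow> real^2 \<Rightarrow> real" where
  "patankar_weight d p q y = (\<Prod>j\<in>{j. d $ j < 0}. patankar d p q y $ j / p $ j) powr q"

text \<open>Under this condition the Patankar product has at most one factor, which reduces the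
  implicit system to one scalar equation.\<close>

definition at_most_one_negative :: "real^2 \<Rightarrow> bool" where
  "at_most_one_negative d \<longleftrightarrow> (\<forall>i j. d $ i < 0 \<longrightarrow> d $ j < 0 \<longrightarrow> i = j)"

lemma at_most_one_negative_cases:
  assumes "at_most_one_negative d"
  obtains "{j. d $ j < 0} = {}" | m where "{j. d $ j < 0} = {m}" "d $ m < 0"
  using assms unfolding at_most_one_negative_def by blast

text \<open>Without a negative entry the step is explicit. With a single negative entry
  \<open>m\<close>, component \<open>m\<close> solves the scalar equation with
  \<open>K = - d $ m\<close>; it then determines the other component, which cannot decrease.\<close>

lemma patankar_eq_ex1:
  assumes d: "at_most_one_negative d"
    and y: "y \<in> pos_quadrant" and p: "p \<in> pos_quadrant" and q: "q > 0"
  shows "\<exists>!z. z \<in> pos_quadrant \<and> patankar_eq d p q y z"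
  using d
proof (cases rule: at_most_one_negative_cases)
  case 1
  then have nn: "d $ i \<ge> 0" for i
    by (metis empty_Collect_eq not_less)
  show ?thesis
  proof (rule ex1I[of _ "y + d"])
    show "y + d \<in> pos_quadrant \<and> patankar_eq d p q y (y + d)"
      using y nn by (auto simp: patankar_eq_def 1 pos_quadrant_def add_pos_nonneg)
  qed (simp add: patankar_eq_def 1 vec_eq_iff)
next
  case (2 m)
  have "\<exists>!s. s > 0 \<and> s + - d $ m * (s / p $ m) powr q = y $ m"
    using 2 y p q by (intro powr_equation_unique_solution) (auto simp: pos_quadrant_def)
  then obtain s where s: "s > 0" "s + - d $ m * (s / p $ m) powr q = y $ m"
    and uniq: "\<And>t. t > 0 \<Longrightarrow> t + - d $ m * (t / p $ m) powr q = y $ m \<Longrightarrow> t = s"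
    by (elim ex1E) blast
  define z where "z = (\<chi> i. y $ i + d $ i * (s / p $ m) powr q)"
  have zm: "z $ m = s"
    using s(2) by (simp add: z_def)
  show ?thesis
  proof (rule ex1I[of _ z])
    have "z $ i > 0" for i
    proof (cases "i = m")
      case True
      then show ?thesis using zm s(1) by simp
    next
      case False
      then have "\<not> d $ i < 0" using 2 by auto
      then show ?thesis
        using y by (simp add: z_def pos_quadrant_def add_pos_nonneg)
    qed
    then show "z \<in> pos_quadrant \<and> patankar_eq d p q y z"
      by (simp add: pos_quadrant_def patankar_eq_def 2(1) zm) (simp add: z_def)
  next
    fix z' assume z': "z' \<in> pos_quadrant \<and> patankar_eq d p q y z'"
    have prod_m: "(\<Prod>j\<in>{m}. z' $ j / p $ j) = z' $ m / p $ m"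
      by simp
    have eq: "z' $ i = y $ i + d $ i * (z' $ m / p $ m) powr q" for i
      using z' unfolding patankar_eq_def 2(1) prod_m by blast
    have "z' $ m = s"
    proof (rule uniq)
      show "z' $ m > 0"
        using z' by (simp add: pos_quadrant_def)
      show "z' $ m + - d $ m * (z' $ m / p $ m) powr q = y $ m"
        using eq[of m] by linarith
    qed
    then have "z' $ i = z $ i" for i
      unfolding z_def by (subst eq) simp
    then show "z' = z"
      by (simp add: vec_eq_iff)
  qed
qed

context
  fixes d p y :: "real^2" and q :: real
  assumes d: "at_most_one_negative d"
    and y: "y \<in> pos_quadrant" and p: "p \<in> pos_quadrant" and q: "q > 0"
begin

lemma patankar_props:
  "patankar d p q y \<in> pos_quadrant" "patankar_eq d p q y (patankar d p q y)"
  using theI'[OF patankar_eq_ex1[OF d y p q]] by (auto simp: patankar_def)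

lemma patankar_conv: "patankar d p q y = y + patankar_weight d p q y *\<^sub>R d"
proof (rule vec_eq_iff[THEN iffD2], rule allI)
  fix i
  have "patankar d p q y $ i = y $ i + d $ i * patankar_weight d p q y"
    using patankar_props(2) unfolding patankar_eq_def patankar_weight_def by blast
  also have "\<dots> = (y + patankar_weight d p q y *\<^sub>R d) $ i"
    by simp
  finally show "patankar d p q y $ i = (y + patankar_weight d p q y *\<^sub>R d) $ i" .
qed

lemma patankar_weight_nonneg: "patankar_weight d p q y \<ge> 0"
  by (simp add: patankar_weight_def)

text \<open>The component with negative direction decreases, so in the ratio the unknown solution
  may be replaced by \<open>y\<close>. Summing over all indices gives a bound that does not depend
  on which index is active.\<close>

lemma patankar_weight_le: "patankar_weight d p q y \<le> 1 + (\<Sum>j\<in>UNIV. (y $ j / p $ j) powr q)"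
  using d
proof (cases rule: at_most_one_negative_cases)
  case 1
  then show ?thesis by (simp add: patankar_weight_def sum_nonneg)
next
  case (2 m)
  have "patankar d p q y $ m \<le> y $ m"
    using 2(2) patankar_weight_nonneg
    by (simp add: patankar_conv mult_nonneg_nonpos)
  then have "patankar_weight d p q y \<le> (y $ m / p $ m) powr q"
    using patankar_props(1) p q
    by (auto simp: patankar_weight_def 2(1) pos_quadrant_def less_imp_le
        intro!: powr_mono2 divide_right_mono)
  also have "\<dots> \<le> (\<Sum>j\<in>UNIV. (y $ j / p $ j) powr q)"
    by (intro member_le_sum) auto
  finally show ?thesis by linarith
qed

text \<open>The active index jumps with the signs of \<open>d\<close>; the sum dominates the
  deviation in every case and so can be used for limits.\<close>

lemma patankar_weight_near_1:
  "\<bar>patankar_weight d p q y - 1\<bar> \<le> (\<Sum>j\<in>UNIV. \<bar>(patankar d p q y $ j / p $ j) powr q - 1\<bar>)"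
  using d
proof (cases rule: at_most_one_negative_cases)
  case 1
  then show ?thesis by (simp add: patankar_weight_def sum_nonneg)
next
  case (2 m)
  have "\<bar>(patankar d p q y $ m / p $ m) powr q - 1\<bar>
      \<le> (\<Sum>j\<in>UNIV. \<bar>(patankar d p q y $ j / p $ j) powr q - 1\<bar>)"
    by (intro member_le_sum[where f = "\<lambda>j. \<bar>(patankar d p q y $ j / p $ j) powr q - 1\<bar>"]) auto
  then show ?thesis
    by (simp add: patankar_weight_def 2(1))
qed

end

text \<open>Two passes break the circularity: the a priori bound on the weight makes the increment
  vanish with \<open>d\<close>, so the solution tends to \<open>v\<close>; then all ratios tend to
  1, and with them the weight.\<close>

lemma patankar_limits:
  fixes d p y :: "'a \<Rightarrow> real^2" and q :: "'a \<Rightarrow> real"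
  assumes ev: "\<forall>\<^sub>F x in F. at_most_one_negative (d x)" "\<forall>\<^sub>F x in F. y x \<in> pos_quadrant"
      "\<forall>\<^sub>F x in F. p x \<in> pos_quadrant" "\<forall>\<^sub>F x in F. q x > 0"
    and lim: "(d \<longlongrightarrow> 0) F" "(y \<longlongrightarrow> v) F" "(p \<longlongrightarrow> v) F" "(q \<longlongrightarrow> q0) F"
    and v: "v \<in> pos_quadrant"
  shows "((\<lambda>x. patankar (d x) (p x) (q x) (y x)) \<longlongrightarrow> v) F"
    and "((\<lambda>x. patankar_weight (d x) (p x) (q x) (y x)) \<longlongrightarrow> 1) F"
proof -
  let ?z = "\<lambda>x. patankar (d x) (p x) (q x) (y x)"
  let ?w = "\<lambda>x. patankar_weight (d x) (p x) (q x) (y x)"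
  let ?B = "\<lambda>x. 1 + (\<Sum>j\<in>UNIV. (y x $ j / p x $ j) powr q x)"
  have v0: "v $ j \<noteq> 0" for j
    using v by (metis less_irrefl mem_Collect_eq pos_quadrant_def)
  have ratio: "((\<lambda>x. (f x $ j / p x $ j) powr q x) \<longlongrightarrow> 1) F" if "(f \<longlongrightarrow> v) F" for f j
  proof -
    have "((\<lambda>x. (f x $ j / p x $ j) powr q x) \<longlongrightarrow> (v $ j / v $ j) powr q0) F"
      by (intro tendsto_powr tendsto_divide tendsto_vec_nth that lim) (simp_all add: v0)
    then show ?thesis by (simp add: v0)
  qed
  have ev': "\<forall>\<^sub>F x in F. at_most_one_negative (d x) \<and> y x \<in> pos_quadrant \<and> p x \<in> pos_quadrant
      \<and> q x > 0"
    using ev by (simp add: eventually_conj)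
  have "((\<lambda>x. ?B x * norm (d x)) \<longlongrightarrow> (1 + (\<Sum>j\<in>(UNIV :: 2 set). 1)) * norm (0 :: real^2)) F"
    by (intro tendsto_intros ratio lim)
  then have "((\<lambda>x. ?B x * norm (d x)) \<longlongrightarrow> 0) F"
    by simp
  moreover have "\<forall>\<^sub>F x in F. norm (?z x - y x) \<le> ?B x * norm (d x)"
    using ev'
  proof (rule eventually_mono)
    fix x assume "at_most_one_negative (d x) \<and> y x \<in> pos_quadrant \<and> p x \<in> pos_quadrant
      \<and> q x > 0"
    then show "norm (?z x - y x) \<le> ?B x * norm (d x)"
      using patankar_weight_le[of "d x" "y x" "p x" "q x"] patankar_conv[of "d x" "y x" "p x" "q x"]
        patankar_weight_nonneg[of "d x" "y x" "p x" "q x"]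
      by (auto intro!: mult_right_mono)
  qed
  ultimately have "((\<lambda>x. ?z x - y x) \<longlongrightarrow> 0) F"
    by (rule Lim_null_comparison[rotated])
  from tendsto_add[OF this lim(2)] show z: "(?z \<longlongrightarrow> v) F"
    by simp
  have "((\<lambda>x. \<Sum>j\<in>UNIV. \<bar>(?z x $ j / p x $ j) powr q x - 1\<bar>)
      \<longlongrightarrow> (\<Sum>j\<in>(UNIV :: 2 set). \<bar>1 - 1 :: real\<bar>)) F"
    by (intro tendsto_intros ratio[OF z])
  then have "((\<lambda>x. \<Sum>j\<in>UNIV. \<bar>(?z x $ j / p x $ j) powr q x - 1\<bar>) \<longlongrightarrow> 0) F"
    by simp
  moreover have "\<forall>\<^sub>F x in F. norm (?w x - 1) \<le> (\<Sum>j\<in>UNIV. \<bar>(?z x $ j / p x $ j) powr q x - 1\<bar>)"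
    using ev' by (rule eventually_mono) (auto intro!: patankar_weight_near_1)
  ultimately have "((\<lambda>x. ?w x - 1) \<longlongrightarrow> 0) F"
    by (rule Lim_null_comparison[rotated])
  from tendsto_add[OF this tendsto_const[of 1]] show "(?w \<longlongrightarrow> 1) F"
    by simp
qed

text \<open>Scaling by positive \<open>h\<close> and \<alpha> preserves signs, so the products range
  over the same indices and the defining predicates coincide.\<close>

lemma gbbks2_conv_patankar:
  assumes "h > 0" "\<alpha> > 0"
  shows "gbbks2 \<alpha> h A p q s r y =
    (let y2 = patankar ((\<alpha> * h) *\<^sub>R (A *v y)) (p y) (q y) y
     in patankar (h *\<^sub>R ((1 - 1 / (2 * \<alpha>)) *\<^sub>R (A *v y) + (1 / (2 * \<alpha>)) *\<^sub>R (A *v y2)))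
          (s (y, y2)) (r y) y)"
proof -
  have 1: "gbbks2_stage_eq \<alpha> h A p q y = patankar_eq ((\<alpha> * h) *\<^sub>R (A *v y)) (p y) (q y) y"
    using assms by (intro ext) (simp add: gbbks2_stage_eq_def patankar_eq_def mult_less_0_iff)
  have 2: "gbbks2_update_eq \<alpha> h A s r y y2 = patankar_eq
      (h *\<^sub>R ((1 - 1 / (2 * \<alpha>)) *\<^sub>R (A *v y) + (1 / (2 * \<alpha>)) *\<^sub>R (A *v y2))) (s (y, y2)) (r y) y" for y2
  proof -
    have "(h * x < 0) = (x < 0)" for x :: real
      using assms by (simp add: mult_less_0_iff)
    then show ?thesis
      by (intro ext) (simp add: gbbks2_update_eq_def patankar_eq_def Let_def)
  qed
  show ?thesis
    by (simp add: gbbks2_def 1 2 patankar_def Let_def)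
qed

section \<open>The linear test system\<close>

lemma C2_on_imp_tendsto:
  assumes "C2_on S f" "x \<in> S"
  shows "(f \<longlongrightarrow> f x) (nhds x)"
proof -
  from assms obtain f' where "(f has_derivative blinfun_apply (f' x)) (at x)"
    unfolding C2_on_def by blast
  then have "isCont f x"
    by (rule has_derivative_continuous)
  then show ?thesis
    by (simp add: isCont_def tendsto_at_iff_tendsto_nhds)
qed

lemma open_pos_quadrant: "open pos_quadrant"
proof -
  have "open (\<Inter>i\<in>UNIV. {y :: real^2. 0 < y $ i})"
    by (intro open_INT finite ballI open_Collect_less continuous_intros)
  also have "(\<Inter>i\<in>UNIV. {y :: real^2. 0 < y $ i}) = pos_quadrant"
    by (auto simp: pos_quadrant_def)
  finally show ?thesis .
qed

text \<open>Node times weight, \<open>\<alpha> * (1 / (2 * \<alpha>))\<close>, is 1/2, whatever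
  \<alpha> is.\<close>

lemma rk2_stability_function_eq:
  assumes "\<alpha> \<noteq> 0"
  shows "rk2_stability_function \<alpha> z = 1 + z + z\<^sup>2 / 2"
  using assms
  by (simp add: rk2_stability_function_def rk2_step_def Let_def scaleR_conv_of_real
      power2_eq_square field_simps)

text \<open>\<open>A\<close> has rank one: it is the column (-c, 1) times the row (a, -b).\<close>

lemma test_matrix_mult:
  fixes A :: "real^2^2"
  assumes "A = vector [vector [- a * c, b * c], vector [a, - b]]"
  shows "A *v y = (a * y $ 1 - b * y $ 2) *\<^sub>R vector [- c, 1]"
  by (simp add: assms vec_eq_iff forall_2 matrix_vector_mult_def sum_2 algebra_simps)

text \<open>Since (1, c) is a left null vector of \<open>A\<close>, pairing it with the eigenvector
  equation gives \<open>(\<mu> - 1) * (v $ 1 + c * v $ 2) = 0\<close>. So \<mu> = 1, or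
  \<open>v\<close> is a multiple of (-c, 1), which spans the range of \<open>A\<close>.\<close>

lemma eigenvalues_test_matrix:
  fixes A :: "real^2^2" and k :: real
  assumes "A = vector [vector [- a * c, b * c], vector [a, - b]]" "a > 0"
  shows "eigenvalues (mat 1 + k *\<^sub>R A) =
    {1, complex_of_real (1 - k * (a * c + b))}" (is "?L = ?R")
proof -
  define M where "M = map_matrix complex_of_real (mat 1 + k *\<^sub>R A)"
  have M: "M *v v = \<mu> *s v \<longleftrightarrow>
      v $ 1 + k * (- a * c * v $ 1 + b * c * v $ 2) = \<mu> * v $ 1 \<and>
      v $ 2 + k * (a * v $ 1 - b * v $ 2) = \<mu> * v $ 2" for v \<mu>
    by (simp add: M_def assms(1) vec_eq_iff forall_2 matrix_vector_mult_def sum_2 map_matrix_def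
        mat_def algebra_simps)
  have "\<mu> \<in> ?R" if v: "v \<noteq> 0" "M *v v = \<mu> *s v" for v \<mu>
  proof (cases "v $ 1 + c * v $ 2 = 0")
    case False
    have "\<mu> * v $ 1 = v $ 1 + k * (- a * c * v $ 1 + b * c * v $ 2)"
        "\<mu> * v $ 2 = v $ 2 + k * (a * v $ 1 - b * v $ 2)"
      using v(2) unfolding M by simp_all
    then have "\<mu> * v $ 1 + c * (\<mu> * v $ 2) = v $ 1 + c * v $ 2"
      by (simp only:) (simp add: algebra_simps)
    then have "(\<mu> - 1) * (v $ 1 + c * v $ 2) = 0"
      by (simp add: algebra_simps)
    with False show ?thesis by simp
  next
    case True
    then have v1: "v $ 1 = - c * v $ 2"
      by (simp add: eq_neg_iff_add_eq_0)
    then have "v $ 2 \<noteq> 0"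
      using v(1) by (auto simp: vec_eq_iff forall_2)
    moreover have "(\<mu> - (1 - k * (a * c + b))) * v $ 2 = 0"
      using v(2) unfolding M v1 by (simp add: algebra_simps)
    ultimately show ?thesis by simp
  qed
  \<comment> \<open>The witnesses are the kernel vector (b, a) here and the range vector (-c, 1)
    below.\<close>
  moreover have "\<exists>v. v \<noteq> 0 \<and> M *v v = 1 *s v"
    using assms(2) unfolding M
    by (intro exI[of _ "vector [complex_of_real b, complex_of_real a]"])
      (simp add: vec_eq_iff forall_2 algebra_simps)
  moreover have "\<exists>v. v \<noteq> 0 \<and> M *v v = complex_of_real (1 - k * (a * c + b)) *s v"
    unfolding M
    by (intro exI[of _ "vector [- complex_of_real c, 1]"])
      (simp add: vec_eq_iff forall_2 algebra_simps)
  ultimately show ?thesis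
    by (auto simp: eigenvalues_def M_def[symmetric])
qed

theorem corollary13:
  fixes a b c dt \<alpha> :: real
    and A :: "real^2^2"
    and ystar :: "real^2"
    and \<pi>1 \<pi>2 q r :: "real^2 \<Rightarrow> real"
    and \<pi> :: "real^2 \<Rightarrow> real^2"
    and \<sigma> :: "(real^2) \<times> (real^2) \<Rightarrow> real^2"
    and D :: "(real^2) set"
    and g :: "real^2 \<Rightarrow> real^2"
    and R :: "complex \<Rightarrow> complex"
  assumes "a > 0" "b > 0" "c > 0" "dt > 0" "\<alpha> \<ge> 1 / 2"
    and A: "A = vector [vector [- a * c, b * c], vector [a, - b]]"
    and ystar: "ystar \<in> pos_quadrant" "A *v ystar = 0"
    and C2: "C2_on pos_quadrant \<pi>1" "C2_on pos_quadrant \<pi>2"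
      "C2_on pos_quadrant r" "C2_on pos_quadrant q"
      "C2_on (pos_quadrant \<times> pos_quadrant) \<sigma>"
    and pos: "\<And>v. v \<in> pos_quadrant \<Longrightarrow> \<pi>1 v > 0 \<and> \<pi>2 v > 0 \<and> r v > 0 \<and> q v > 0"
      "\<And>v w. v \<in> pos_quadrant \<Longrightarrow> w \<in> pos_quadrant \<Longrightarrow> \<sigma> (v, w) \<in> pos_quadrant"
    and \<pi>: "\<pi> = (\<lambda>v. vector [\<pi>1 v, \<pi>2 v])"
    and D: "open D" "ystar \<in> D"
    and steady: "\<And>v. v \<in> D \<inter> pos_quadrant \<Longrightarrow> A *v v = 0 \<Longrightarrow> \<sigma> (v, v) = v \<and> \<pi> v = v"
    and g: "g = gbbks2 \<alpha> dt A \<pi> q \<sigma> r"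
    and R: "R = rk2_stability_function \<alpha>"
  shows "(\<forall>z. R z = 1 + z + z\<^sup>2 / 2) \<and>
    has_stability_function g ystar dt (- (a * c + b)) R \<and>
    (cmod (R (complex_of_real (- (a * c + b) * dt))) < 1 \<longrightarrow>
      stable_fixed_point pos_quadrant g ystar \<and>
      (\<exists>\<delta>>0. \<forall>y0\<in>pos_quadrant.
         inner (vector [1, c]) y0 = inner (vector [1, c]) ystar \<and> norm (y0 - ystar) < \<delta> \<longrightarrow>
         (\<lambda>n. (g ^^ n) y0) \<longlonglongrightarrow> ystar)) \<and>
    (cmod (R (complex_of_real (- (a * c + b) * dt))) > 1 \<longrightarrow>
      unstable_fixed_point pos_quadrant g ystar)"
proof -
  define l where "l = - (a * c + b)"
  \<comment> \<open>This is the factor \<open>G\<close> with both Patankar weights set to 1; it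
    satisfies \<open>1 + l * k = R (dt * l)\<close>.\<close>
  define k where "k = dt * (1 + dt * l / 2)"
  define u :: "real^2" where "u = vector [- c, 1]"
  have ac: "a * c > 0"
    using assms by simp
  then have l: "l < 0"
    using \<open>b > 0\<close> by (simp add: l_def)
  have \<alpha>: "\<alpha> > 0"
    using \<open>\<alpha> \<ge> 1 / 2\<close> by linarith
  note Av = test_matrix_mult[OF A, folded u_def]
  have AA: "A *v (A *v v) = l *\<^sub>R (A *v v)" for v
    unfolding Av by (simp add: u_def l_def algebra_simps)
  \<comment> \<open>Multiples of (-c, 1) with \<open>c > 0\<close> have components of opposite sign,
    or vanish.\<close>
  have neg: "at_most_one_negative (t *\<^sub>R (A *v v))" for t v
    using \<open>c > 0\<close>
    by (auto simp: at_most_one_negative_def Av u_def forall_2 mult_less_0_iff zero_less_mult_iff)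
  have bl: "bounded_linear ((*v) A)"
    by (rule matrix_vector_mul_bounded_linear)
  have \<pi>_quad: "\<pi> v \<in> pos_quadrant" if "v \<in> pos_quadrant" for v
    using pos(1)[OF that] by (simp add: \<pi> pos_quadrant_def forall_2)
  have st: "\<pi> ystar = ystar" "\<sigma> (ystar, ystar) = ystar"
    using steady[of ystar] D ystar by auto

  \<comment> \<open>The scheme as two Patankar steps along \<open>A *v y\<close>\<close>
  define y2 where "y2 y = patankar ((\<alpha> * dt) *\<^sub>R (A *v y)) (\<pi> y) (q y) y" for y
  define \<phi> where "\<phi> y = patankar_weight ((\<alpha> * dt) *\<^sub>R (A *v y)) (\<pi> y) (q y) y" for y
  \<comment> \<open>The weighted slope after substituting \<open>A *v y2 y = (1 + \<alpha> * dt *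
    \<phi> y * l) *\<^sub>R (A *v y)\<close>; \<alpha> cancels against the weight
    \<open>1 / (2 * \<alpha>)\<close>.\<close>
  define d where "d y = (dt * (1 + dt * l / 2 * \<phi> y)) *\<^sub>R (A *v y)" for y
  define \<psi> where "\<psi> y = patankar_weight (d y) (\<sigma> (y, y2 y)) (r y) y" for y
  define G where "G y = dt * (1 + dt * l / 2 * \<phi> y) * \<psi> y" for y

  have y2: "y2 y \<in> pos_quadrant" "y2 y = y + (\<alpha> * dt * \<phi> y) *\<^sub>R (A *v y)"
    if y: "y \<in> pos_quadrant" for y
  proof -
    have ok: "at_most_one_negative ((\<alpha> * dt) *\<^sub>R (A *v y))" "y \<in> pos_quadrant"
        "\<pi> y \<in> pos_quadrant" "q y > 0"
      using neg y \<pi>_quad pos(1) by auto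
    show "y2 y \<in> pos_quadrant" "y2 y = y + (\<alpha> * dt * \<phi> y) *\<^sub>R (A *v y)"
      using patankar_props(1)[OF ok] patankar_conv[OF ok] by (simp_all add: y2_def \<phi>_def mult.commute)
  qed
  have g_pat: "g y = patankar (d y) (\<sigma> (y, y2 y)) (r y) y" if y: "y \<in> pos_quadrant" for y
  proof -
    have "A *v y2 y = (1 + \<alpha> * dt * \<phi> y * l) *\<^sub>R (A *v y)"
      unfolding y2(2)[OF y] by (simp add: linear_simps[OF bl] AA scaleR_left_distrib)
    then have "d y = dt *\<^sub>R ((1 - 1 / (2 * \<alpha>)) *\<^sub>R (A *v y) + (1 / (2 * \<alpha>)) *\<^sub>R (A *v y2 y))"
      using \<alpha> by (simp add: d_def scaleR_left_distrib[symmetric] field_simps del: scaleR_left_distrib)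
    then show ?thesis
      by (simp add: g gbbks2_conv_patankar[OF \<open>dt > 0\<close> \<alpha>] y2_def[symmetric] Let_def)
  qed
  have g_eq: "g y = y + G y *\<^sub>R (A *v y)" if y: "y \<in> pos_quadrant" for y
  proof -
    have ok: "at_most_one_negative (d y)" "y \<in> pos_quadrant" "\<sigma> (y, y2 y) \<in> pos_quadrant" "r y > 0"
      using neg y y2(1)[OF y] pos by (auto simp: d_def)
    have "g y = y + \<psi> y *\<^sub>R d y"
      unfolding g_pat[OF y] \<psi>_def by (rule patankar_conv[OF ok])
    then show ?thesis
      by (simp add: d_def G_def mult_ac)
  qed

  \<comment> \<open>Limits of stage, weights and scalar factor at the steady state\<close>
  have quad: "\<forall>\<^sub>F y in nhds ystar. y \<in> pos_quadrant"
    using open_pos_quadrant ystar(1) by (rule eventually_nhds_in_open)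
  have id_lim: "((\<lambda>y. y) \<longlongrightarrow> ystar) (nhds ystar)"
    by (simp add: filterlim_ident)
  have A_lim: "((\<lambda>y. A *v y) \<longlongrightarrow> 0) (nhds ystar)"
    using bounded_linear.tendsto[OF bl id_lim] ystar(2) by simp
  have \<pi>_lim: "(\<pi> \<longlongrightarrow> ystar) (nhds ystar)"
  proof -
    have "((\<lambda>v. \<pi> v $ i) \<longlongrightarrow> \<pi> ystar $ i) (nhds ystar)" for i
      using exhaust_2[of i] C2_on_imp_tendsto[OF C2(1) ystar(1)]
        C2_on_imp_tendsto[OF C2(2) ystar(1)]
      by (auto simp: \<pi>)
    then show ?thesis
      using st(1) by (auto intro: vec_tendstoI)
  qed
  have "((\<lambda>y. (\<alpha> * dt) *\<^sub>R (A *v y)) \<longlongrightarrow> (\<alpha> * dt) *\<^sub>R 0) (nhds ystar)"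
    by (intro tendsto_intros A_lim)
  then have stage_lim: "((\<lambda>y. (\<alpha> * dt) *\<^sub>R (A *v y)) \<longlongrightarrow> 0) (nhds ystar)"
    by simp
  have "\<forall>\<^sub>F y in nhds ystar. \<pi> y \<in> pos_quadrant" "\<forall>\<^sub>F y in nhds ystar. q y > 0"
    using pos(1) \<pi>_quad by (auto intro: eventually_mono[OF quad])
  note stage = patankar_limits[OF always_eventually[OF allI[OF neg]] quad this stage_lim id_lim
      \<pi>_lim C2_on_imp_tendsto[OF C2(4) ystar(1)] ystar(1)]
  have y2_lim: "(y2 \<longlongrightarrow> ystar) (nhds ystar)" and \<phi>_lim: "(\<phi> \<longlongrightarrow> 1) (nhds ystar)"
    using stage unfolding y2_def[abs_def] \<phi>_def[abs_def] .
  \<comment> \<open>The stage value tends to \<open>ystar\<close>, so continuity of \<sigma> at the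
    diagonal point \<open>(ystar, ystar)\<close> gives the denominators of the update the limit
    \<open>ystar\<close>.\<close>
  have \<sigma>_lim: "((\<lambda>y. \<sigma> (y, y2 y)) \<longlongrightarrow> ystar) (nhds ystar)"
    using filterlim_compose[OF C2_on_imp_tendsto[OF C2(5)] tendsto_Pair[OF id_lim y2_lim]]
      ystar(1) st(2) by simp
  have "(d \<longlongrightarrow> (dt * (1 + dt * l / 2 * 1)) *\<^sub>R 0) (nhds ystar)"
    unfolding d_def[abs_def] by (intro tendsto_intros \<phi>_lim A_lim)
  then have d_lim: "(d \<longlongrightarrow> 0) (nhds ystar)"
    by simp
  have d_neg: "at_most_one_negative (d y)" for y
    unfolding d_def by (rule neg)
  have "\<forall>\<^sub>F y in nhds ystar. \<sigma> (y, y2 y) \<in> pos_quadrant" "\<forall>\<^sub>F y in nhds ystar. r y > 0"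
    using pos y2(1) by (auto intro: eventually_mono[OF quad])
  then have \<psi>_lim: "(\<psi> \<longlongrightarrow> 1) (nhds ystar)"
    unfolding \<psi>_def[abs_def]
    by (rule patankar_limits(2)[OF always_eventually[OF allI[OF d_neg]] quad _ _ d_lim id_lim
        \<sigma>_lim C2_on_imp_tendsto[OF C2(3) ystar(1)] ystar(1)])
  have G_lim: "(G \<longlongrightarrow> k) (nhds ystar)"
    unfolding G_def[abs_def] k_def by (auto intro!: tendsto_eq_intros \<phi>_lim \<psi>_lim)

  \<comment> \<open>Spectrum of the Jacobian and the stability claims\<close>
  interpret range_iteration "(*v) A" g G pos_quadrant ystar l k
    using AA l open_pos_quadrant ystar g_eq G_lim by (intro range_iteration.intro bl) auto

  have R_eq: "R z = 1 + z + z\<^sup>2 / 2" for z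
    using \<alpha> by (simp add: R rk2_stability_function_eq)
  have R_real: "R (complex_of_real (dt * l)) = complex_of_real (1 + l * k)"
    by (simp add: R_eq k_def power2_eq_square algebra_simps)
  have cmod_R: "cmod (R (complex_of_real (- (a * c + b) * dt))) = \<bar>1 + l * k\<bar>"
    using R_real by (metis l_def mult.commute norm_of_real)
  have "jacobian g (at ystar) = mat 1 + k *\<^sub>R A"
  proof -
    have "jacobian g (at ystar) = matrix (\<lambda>v. v + k *\<^sub>R (A *v v))"
      by (simp add: jacobian_def frechet_derivative_at[OF has_derivative_g, symmetric])
    also have "(\<lambda>v. v + k *\<^sub>R (A *v v)) = (*v) (mat 1 + k *\<^sub>R A)"
      by (simp add: fun_eq_iff matrix_vector_mult_add_rdistrib scaleR_matrix_vector_assoc)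
    finally show ?thesis by simp
  qed
  moreover have "1 - k * (a * c + b) = 1 + l * k"
    by (simp add: l_def algebra_simps)
  ultimately have "eigenvalues (jacobian g (at ystar)) = {1, R (complex_of_real (dt * l))}"
    by (simp only: eigenvalues_test_matrix[OF A \<open>a > 0\<close>] R_real)
  then have "has_stability_function g ystar dt l R"
    using has_derivative_g unfolding has_stability_function_def differentiable_def by blast
  moreover have "\<exists>\<delta>>0. \<forall>y0\<in>pos_quadrant.
      inner (vector [1, c]) y0 = inner (vector [1, c]) ystar \<and> norm (y0 - ystar) < \<delta> \<longrightarrow>
      (\<lambda>n. (g ^^ n) y0) \<longlonglongrightarrow> ystar" if "\<bar>1 + l * k\<bar> < 1"
  proof -
    \<comment> \<open>Equal values under (1, c) make the difference a multiple of (-c, 1), an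
      eigenvector of \<open>A\<close> for \<open>l\<close>.\<close>
    have "l *\<^sub>R (y - ystar) = A *v (y - ystar)"
      if "inner (vector [1, c]) y = inner (vector [1, c]) ystar" for y
    proof -
      define w where "w = y - ystar"
      have "w $ 1 = - c * w $ 2"
        using that by (simp add: w_def inner_vec_def sum_2 algebra_simps)
      then have "l *\<^sub>R w = A *v w"
        by (simp add: Av u_def l_def vec_eq_iff forall_2 algebra_simps)
      then show ?thesis
        by (simp add: w_def)
    qed
    then show ?thesis
      using convergent_in_fibre[OF that] by blast
  qed
  \<comment> \<open>The escape direction for instability: \<open>A *v u = l *\<^sub>R u\<close>,
    with \<open>l < 0\<close>.\<close>
  moreover have "A *v u \<noteq> 0"
    using AA[of u] l ac \<open>b > 0\<close> by (simp add: Av u_def vec_eq_iff forall_2)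
  ultimately show ?thesis
    using R_eq cmod_R stable unstable[of u] by (simp add: l_def)
qed

end
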